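(* Let $f:\mathbb{R}\to\mathbb{R}$ be a bounded function with bounded continuous second derivatives, and define the vector field $\xi:\mathbb{R}^2\to\mathbb{R}^2$ by $\xi(x)=2f'(|x|^2)\,x^\perp$, where $x^\perp=(-x_2,x_1)$ for $x=(x_1,x_2)$. Then for every $x\in\mathbb{R}^2$ $$-D\xi(x)\,\xi(x)=4f'(|x|^2)^2\,x.$$
   Context: $D\xi(x)$ is the Jacobian matrix of $\xi$, $(D\xi)_{ij}=\partial_j\xi_i$. *)

theory Defs
  imports "HOL-Analysis.Analysis"
begin

definition perp :: "real^2 \<Rightarrow> real^2"
  where "perp x = vector [- (x $ 2), x $ 1]"

definition rot_field :: "(real \<Rightarrow> real) \<Rightarrow> real^2 \<Rightarrow> real^2"
  where "rot_field f x = (2 * deriv f ((norm x)\<^sup>2)) *\<^sub>R perp x"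

(* jacobian is defined in HOL-Analysis through the Frechet derivative. The lemmas below
   justify reading its entries as the partial derivatives d_j xi_i: where the field is
   differentiable they agree, and rot_field f is differentiable for twice differentiable f. *)

lemma has_partial_derivative_jacobian:
  fixes \<xi> :: "real^'n \<Rightarrow> real^'m"
  assumes "\<xi> differentiable (at x)"
  shows "((\<lambda>t. \<xi> (x + t *\<^sub>R axis j 1) $ i) has_real_derivative
            jacobian \<xi> (at x) $ i $ j) (at 0)"
proof -
  let ?D = "frechet_derivative \<xi> (at x)"
  have D: "(\<xi> has_derivative ?D) (at x)"
    using assms frechet_derivative_works by blast
  have L: "((\<lambda>t. x + t *\<^sub>R axis j 1) has_derivative (\<lambda>t. t *\<^sub>R axis j 1)) (at 0)"
    by (auto intro!: derivative_eq_intros)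
  have "((\<lambda>t. \<xi> (x + t *\<^sub>R axis j 1)) has_derivative (\<lambda>t. ?D (t *\<^sub>R axis j 1))) (at 0)"
    by (rule has_derivative_compose[OF L]) (use D in simp)
  hence "((\<lambda>t. \<xi> (x + t *\<^sub>R axis j 1) $ i) has_derivative
            (\<lambda>t. ?D (t *\<^sub>R axis j 1) $ i)) (at 0)"
    by (rule bounded_linear.has_derivative[OF bounded_linear_vec_nth])
  moreover have "?D (t *\<^sub>R axis j 1) $ i = jacobian \<xi> (at x) $ i $ j * t" for t
    using linear_scale[OF has_derivative_linear[OF D], of t "axis j 1"]
    by (simp add: jacobian_def matrix_def)
  ultimately show ?thesis
    by (simp add: has_field_derivative_def)
qed

lemma rot_field_differentiable:
  assumes "\<And>t. deriv f differentiable (at t)"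
  shows "rot_field f differentiable (at x)"
proof -
  have perp: "linear perp"
    by (rule linearI) (simp_all add: perp_def vec_eq_iff forall_2)
  have "(\<lambda>x::real^2. x \<bullet> x) differentiable (at x)"
    by (intro differentiable_inner differentiable_ident)
  hence "(\<lambda>x. deriv f (x \<bullet> x)) differentiable (at x)"
    using differentiable_chain_at[of "\<lambda>x. x \<bullet> x" x "deriv f"] assms by (simp add: o_def)
  hence c: "(\<lambda>x. 2 * deriv f (x \<bullet> x)) differentiable (at x)"
    by (rule differentiable_mult[OF differentiable_const])
  have "(\<lambda>x. (2 * deriv f (x \<bullet> x)) *\<^sub>R perp x) differentiable (at x)"
    by (rule differentiable_scaleR[OF c linear_imp_differentiable[OF perp]])
  thus ?thesis
    by (simp add: rot_field_def[abs_def] power2_norm_eq_inner)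
qed

end

theory Submission
  imports Defs
begin

text \<open>
  The field is tangent to the circles centred at the origin, since \<open>x\<close> is orthogonal to
  \<open>perp x\<close>. Hence \<open>(norm x)\<^sup>2\<close>, and with it the coefficient \<open>c = 2 * deriv f ((norm x)\<^sup>2)\<close>, is
  stationary in the direction of the field: the term of the product rule that contains the
  second derivative of \<open>f\<close> vanishes. There remains \<open>c\<close> times the linear map \<open>perp\<close> applied to
  \<open>c *\<^sub>R perp x\<close>, and two quarter turns are \<open>-1\<close>, which leaves \<open>- c\<^sup>2 *\<^sub>R x\<close>. This is the
  centripetal acceleration of the circular flow.
\<close>

lemma linear_perp: "linear perp"
  by (rule linearI) (simp_all add: perp_def vec_eq_iff forall_2)

lemma perp_perp: "perp (perp x) = - x"
  by (simp add: perp_def vec_eq_iff forall_2)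

lemma inner_perp_self: "x \<bullet> perp x = 0"
  by (simp add: perp_def inner_vec_def sum_2)

text \<open>
  The product rule for the coefficient times \<open>perp\<close>. Its first summand has the factor
  \<open>x \<bullet> h\<close>, so that it vanishes on tangential directions.
\<close>

lemma rot_field_has_derivative:
  assumes "deriv f differentiable (at ((norm x)\<^sup>2))"
  shows "(rot_field f has_derivative
           (\<lambda>h. (4 * deriv (deriv f) ((norm x)\<^sup>2) * (x \<bullet> h)) *\<^sub>R perp x
                + (2 * deriv f ((norm x)\<^sup>2)) *\<^sub>R perp h)) (at x)"
proof -
  have "(deriv f has_field_derivative deriv (deriv f) (x \<bullet> x)) (at (x \<bullet> x))"
    using assms by (simp add: DERIV_deriv_iff_real_differentiable power2_norm_eq_inner)
  moreover have "((\<lambda>y. y \<bullet> y) has_derivative (\<lambda>h. 2 * (x \<bullet> h))) (at x)"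
    by (auto intro!: derivative_eq_intros simp: inner_commute)
  ultimately have coeff: "((\<lambda>y. deriv f (y \<bullet> y)) has_derivative
      (\<lambda>h. 2 * (x \<bullet> h) * deriv (deriv f) (x \<bullet> x))) (at x)"
    by (rule DERIV_compose_FDERIV)
  have "(perp has_derivative perp) (at x)"
    by (rule linear_imp_has_derivative[OF linear_perp])
  with coeff have "((\<lambda>y. (2 * deriv f (y \<bullet> y)) *\<^sub>R perp y) has_derivative
      (\<lambda>h. (4 * deriv (deriv f) (x \<bullet> x) * (x \<bullet> h)) *\<^sub>R perp x
           + (2 * deriv f (x \<bullet> x)) *\<^sub>R perp h)) (at x)"
    by (auto intro!: derivative_eq_intros simp: algebra_simps)
  then show ?thesis
    by (simp add: rot_field_def[abs_def] power2_norm_eq_inner)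
qed

theorem proposition5p2:
  fixes f :: "real \<Rightarrow> real" and x :: "real^2"
  assumes "bounded (range f)"
    and "\<And>t. f differentiable (at t)"
    and "\<And>t. deriv f differentiable (at t)"
    and "continuous_on UNIV (deriv (deriv f))"
    and "bounded (range (deriv (deriv f)))"
  shows "- (jacobian (rot_field f) (at x) *v rot_field f x)
           = (4 * (deriv f ((norm x)\<^sup>2))\<^sup>2) *\<^sub>R x"
proof -
  let ?c = "2 * deriv f ((norm x)\<^sup>2)"
  have "(rot_field f has_derivative (\<lambda>h. jacobian (rot_field f) (at x) *v h)) (at x)"
    using rot_field_differentiable[OF assms(3)] jacobian_works by blast
  from has_derivative_unique[OF this rot_field_has_derivative[OF assms(3)]]
  have "jacobian (rot_field f) (at x) *v rot_field f x
      = (4 * deriv (deriv f) ((norm x)\<^sup>2) * (x \<bullet> rot_field f x)) *\<^sub>R perp x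
        + ?c *\<^sub>R perp (rot_field f x)"
    by meson
  also have "\<dots> = ?c *\<^sub>R perp (?c *\<^sub>R perp x)"
    by (simp add: rot_field_def inner_perp_self)
  also have "\<dots> = - ((4 * (deriv f ((norm x)\<^sup>2))\<^sup>2) *\<^sub>R x)"
    by (simp add: linear_scale[OF linear_perp] perp_perp power2_eq_square)
  finally show ?thesis
    by simp
qed

end
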